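(* Let $n\ge 2$ and let $S_n=K_{1,n-1}$ be the star graph with $n$ vertices. Among all vertices of all connected simple graphs with $n$ vertices, the pendant vertices of $S_n$ have the minimum Randić energy; that is, if $u$ is a pendant vertex of $S_n$, then for every connected simple graph $G$ with $n$ vertices and every vertex $v$ of $G$, $$\mathcal{RE}_G(v)\geq \mathcal{RE}_{S_n}(u).$$
   Context: All graphs are finite and simple. For a graph $G$ with vertices $v_1,\dots,v_n$, let $d_i$ be the degree of $v_i$. The Randić matrix $R(G)=(R_{ij})$ is the real symmetric $n\times n$ matrix with $R_{ij}=\frac{1}{\sqrt{d_id_j}}$ if $v_i$ and $v_j$ are adjacent and $R_{ij}=0$ otherwise. Put $|R(G)|=(R(G)R(G)^* )^{1/2}$ (positive semidefinite square root). The Randić energy of the vertex $v_i$ is $\mathcal{RE}_G(v_i)=|R(G)|_{ii}$, the $i$-th diagonal entry of $|R(G)|$. A pendant vertex is a vertex of degree $1$. *)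

theory Defs
  imports "HOL-Analysis.Analysis" "Graph_Theory.Graph_Theory"
begin

text \<open>
  Finite simple graphs are the \<^locale>\<open>graph\<close>s of \<^theory>\<open>Graph_Theory.Graph_Theory\<close>: symmetric,
  loop-free digraphs without parallel arcs. An edge is a pair of opposite arcs, so the degree of
  a vertex is its \<^const>\<open>out_degree\<close>. The matrix below is the Randic matrix of a graph whose
  vertex set is the whole (finite) type \<open>'v\<close>, so that rows and columns are indexed by vertices.
\<close>

definition randic_matrix :: "('v::finite, 'e) pre_digraph \<Rightarrow> real ^ 'v ^ 'v" where
  "randic_matrix G =
    (\<chi> u v. if u \<rightarrow>\<^bsub>G\<^esub> v
            then 1 / sqrt (real (out_degree G u) * real (out_degree G v)) else 0)"

definition pos_semidef :: "real ^ 'n ^ 'n \<Rightarrow> bool" where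
  "pos_semidef A \<longleftrightarrow> transpose A = A \<and> (\<forall>x. 0 \<le> x \<bullet> (A *v x))"

text \<open>The positive semidefinite square root; it exists and is unique when \<open>A\<close> is itself
  positive semidefinite, and is unspecified otherwise.\<close>

definition psd_sqrt :: "real ^ 'n ^ 'n \<Rightarrow> real ^ 'n ^ 'n" where
  "psd_sqrt A = (THE P. pos_semidef P \<and> P ** P = A)"

text \<open>For a real matrix the adjoint is the transpose.\<close>

definition matrix_abs :: "real ^ 'n ^ 'n \<Rightarrow> real ^ 'n ^ 'n" where
  "matrix_abs A = psd_sqrt (A ** transpose A)"

definition randic_energy :: "('v::finite, 'e) pre_digraph \<Rightarrow> 'v \<Rightarrow> real" where
  "randic_energy G v = matrix_abs (randic_matrix G) $ v $ v"

definition pendant :: "('v, 'e) pre_digraph \<Rightarrow> 'v \<Rightarrow> bool" where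
  "pendant G v \<longleftrightarrow> v \<in> verts G \<and> out_degree G v = 1"

end

theory Submission
  imports Defs
begin

text \<open>
  Write \<open>R\<close> for the Randic matrix of \<open>G\<close>. The Randic matrix is a contraction
  (\<open>norm_randic_matrix_mult_le\<close>), because the Cauchy--Schwarz inequality applied to each row
  distributes the weight of every vertex equally among its neighbours. Hence so is the positive
  semidefinite matrix \<open>P = |R|\<close>, and a positive semidefinite contraction dominates its own
  square: \<open>P\<^sup>2 \<le> P\<close> as quadratic forms. On the diagonal this says
  \<open>|R|\<^sub>v\<^sub>v \<ge> (R R\<^sup>T)\<^sub>v\<^sub>v\<close>, and the right-hand side is the sum of \<open>1 / (d\<^sub>v d\<^sub>w)\<close> over the
  \<open>d\<^sub>v\<close> neighbours \<open>w\<close> of \<open>v\<close>. As no degree exceeds \<open>n - 1\<close>, the energy of every non-isolated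
  vertex is at least \<open>1 / (n - 1)\<close> (\<open>randic_energy_ge\<close>).

  This value is attained at the pendant vertices of the star (\<open>randic_energy_star_pendant\<close>). The
  Randic matrix of a star is a partial isometry, its nonzero eigenvalues being \<open>1\<close> and \<open>-1\<close>, so
  that \<open>|R| = R R\<^sup>T\<close> there and the domination above is an equality; moreover the only neighbour
  of a pendant vertex has the largest possible degree.

  The definition of the energy presupposes that \<open>R R\<^sup>T\<close> has exactly one positive semidefinite
  square root. Both halves are shown without diagonalising a matrix. Uniqueness is a trace
  computation with the difference of two roots. Existence comes from the polar decomposition: if
  \<open>U\<close> maximises \<open>trace (A U)\<close> over the compact group of orthogonal matrices, then \<open>A U\<close> is
  positive semidefinite, and its square is \<open>A U (A U)\<^sup>T = A A\<^sup>T\<close>.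
\<close>

section \<open>Uniqueness of positive semidefinite square roots\<close>

lemma inner_symmetric_matrix:
  fixes P :: "real ^ 'n ^ 'n"
  assumes "transpose P = P"
  shows "(P *v x) \<bullet> y = x \<bullet> (P *v y)"
  by (metis assms dot_lmul_matrix transpose_matrix_vector)

text \<open>
  The quadratic form of \<open>P\<close> attains its minimum \<open>0\<close> at \<open>x\<close>, so its gradient \<open>2 P x\<close> vanishes there.
  Concretely, if \<open>P x\<close> were nonzero, a short step from \<open>x\<close> in the direction \<open>- P x\<close> would make the form negative.
\<close>
lemma pos_semidef_null:
  assumes "pos_semidef P" and "x \<bullet> (P *v x) = 0"
  shows "P *v x = 0"
proof -
  define z where "z = P *v x"
  define a where "a = z \<bullet> z"
  define b where "b = z \<bullet> (P *v z)"
  \<comment> \<open>The form at \<open>x - t z\<close> is \<open>t\<^sup>2 b - 2 t a\<close>. Its minimiser is \<open>a / b\<close>; the added \<open>1\<close> covers \<open>b = 0\<close>.\<close>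
  define t where "t = a / (b + 1)"
  have sym: "transpose P = P" using assms(1) by (simp add: pos_semidef_def)
  have b: "b \<ge> 0" using assms(1) by (simp add: pos_semidef_def b_def)
  have a: "a = t * (b + 1)" using b by (simp add: t_def)
  have "0 \<le> (x - t *\<^sub>R z) \<bullet> (P *v (x - t *\<^sub>R z))"
    using assms(1) by (simp add: pos_semidef_def)
  also have "\<dots> = x \<bullet> (P *v x) - t * (x \<bullet> (P *v z)) - t * (z \<bullet> (P *v x)) + t\<^sup>2 * b"
    by (simp add: matrix_vector_mult_diff_distrib matrix_vector_mult_scaleR inner_diff_left
      inner_diff_right b_def power2_eq_square algebra_simps)
  also have "\<dots> = t\<^sup>2 * b - 2 * t * a"
    using inner_symmetric_matrix[OF sym, of x z] by (simp add: assms(2) a_def z_def)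
  also have "\<dots> = - (t\<^sup>2 * (b + 2))"
    unfolding a by (simp add: power2_eq_square algebra_simps)
  finally have "t\<^sup>2 * (b + 2) \<le> 0" by simp
  then have "t = 0" using b by (simp add: mult_le_0_iff)
  then have "a = 0" using a by simp
  then show ?thesis by (simp add: a_def z_def)
qed

lemma trace_congruence:
  fixes P D :: "real ^ 'n ^ 'n"
  shows "trace (transpose D ** (P ** D)) = (\<Sum>i\<in>UNIV. column i D \<bullet> (P *v column i D))"
  by (simp add: trace_def matrix_matrix_mult_def transpose_def column_def inner_vec_def
      matrix_vector_mult_def)

text \<open>
  With \<open>D = P - Q\<close>, equality of the squares gives \<open>P D = - D Q\<close>, hence \<open>trace (D P D) = - trace (D Q D)\<close>.
  Both traces are sums of values of positive semidefinite forms at the columns of \<open>D\<close>, so all these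
  values are \<open>0\<close>. Thus \<open>P\<close> and \<open>Q\<close>, and with them \<open>D\<close>, annihilate the columns of the symmetric
  matrix \<open>D\<close>, which forces \<open>D = 0\<close>.
\<close>
lemma pos_semidef_sqrt_unique:
  assumes P: "pos_semidef P" and Q: "pos_semidef Q" and eq: "P ** P = Q ** Q"
  shows "P = Q"
proof -
  define D where "D = P - Q"
  have sP: "transpose P = P" and sQ: "transpose Q = Q"
    using P Q by (simp_all add: pos_semidef_def)
  have sD: "transpose D = D"
    using sP sQ by (simp add: D_def transpose_def vec_eq_iff)
  have "P ** D = P ** P - P ** Q" and "D ** Q = P ** Q - Q ** Q"
    by (simp_all add: D_def matrix_matrix_mult_def vec_eq_iff sum_subtractf algebra_simps)
  then have anti: "P ** D = - (D ** Q)"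
    by (simp add: eq)
  have "trace (D ** (P ** D)) = - trace (D ** (D ** Q))"
  proof -
    have "D ** - (D ** Q) = - (D ** (D ** Q))"
      unfolding matrix_matrix_mult_def[of D] by (simp add: vec_eq_iff sum_negf)
    then show ?thesis by (simp add: anti trace_def sum_negf)
  qed
  also have "\<dots> = - trace (D ** (Q ** D))"
    by (metis matrix_mul_assoc trace_mul_sym)
  finally have "trace (D ** (P ** D)) + trace (D ** (Q ** D)) = 0" by simp
  then have sum0: "(\<Sum>i\<in>UNIV. column i D \<bullet> (P *v column i D))
      + (\<Sum>i\<in>UNIV. column i D \<bullet> (Q *v column i D)) = 0"
    using trace_congruence[of D P] trace_congruence[of D Q] sD by simp
  have nn: "0 \<le> x \<bullet> (P *v x)" "0 \<le> x \<bullet> (Q *v x)" for x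
    using P Q by (auto simp: pos_semidef_def)
  have "(\<Sum>i\<in>UNIV. column i D \<bullet> (P *v column i D)) = 0"
       "(\<Sum>i\<in>UNIV. column i D \<bullet> (Q *v column i D)) = 0"
    using sum0 nn by (smt (verit) sum_nonneg)+
  then have "P *v column i D = 0" "Q *v column i D = 0" for i
    using nn P Q by (auto simp: sum_nonneg_eq_0_iff intro: pos_semidef_null)
  then have "D *v column i D = 0" for i
    by (simp add: D_def matrix_vector_mult_diff_rdistrib)
  then have "column i D \<bullet> column i D = 0" for i
    using inner_symmetric_matrix[OF sD, of "axis i 1" "column i D"]
    by (simp add: matrix_vector_mul_component matrix_vector_mult_basis)
  then have "D = 0" by (simp add: vec_eq_iff column_def)
  then show ?thesis by (simp add: D_def)
qed

lemma psd_sqrt_eqI: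
  assumes "pos_semidef P" and "P ** P = A"
  shows "psd_sqrt A = P"
  unfolding psd_sqrt_def using assms pos_semidef_sqrt_unique by blast

section \<open>Existence: polar decomposition by maximising a trace\<close>

text \<open>
  The reflection in the hyperplane orthogonal to \<open>w\<close>. For \<open>w = 0\<close> the convention for division by
  zero makes it the identity.
\<close>
definition householder :: "real ^ 'n \<Rightarrow> real ^ 'n ^ 'n" where
  "householder w = (\<chi> i j. (if i = j then 1 else 0) - 2 * w $ i * w $ j / (w \<bullet> w))"

lemma householder_mult_vec: "householder w *v x = x - (2 * (w \<bullet> x) / (w \<bullet> w)) *\<^sub>R w"
proof -
  have "(\<Sum>j\<in>UNIV. ((if i = j then 1 else 0) - 2 * w $ i * w $ j / (w \<bullet> w)) * x $ j)
      = x $ i - 2 * (w \<bullet> x) / (w \<bullet> w) * w $ i" for i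
  proof -
    have "(\<Sum>j\<in>UNIV. ((if i = j then 1 else 0) - 2 * w $ i * w $ j / (w \<bullet> w)) * x $ j)
      = (\<Sum>j\<in>UNIV. (if i = j then x $ j else 0)) - (\<Sum>j\<in>UNIV. (w $ j * x $ j) * (2 * w $ i / (w \<bullet> w)))"
      unfolding sum_subtractf[symmetric] by (rule sum.cong) (auto simp: algebra_simps)
    also have "\<dots> = x $ i - (w \<bullet> x) * (2 * w $ i / (w \<bullet> w))"
      unfolding sum_distrib_right[symmetric] by (simp add: inner_vec_def)
    finally show ?thesis by simp
  qed
  then show ?thesis by (simp add: vec_eq_iff householder_def matrix_vector_mult_def)
qed

lemma orthogonal_matrix_householder: "orthogonal_matrix (householder w)"
proof -
  have "householder w *v (householder w *v x) = x" for x
    by (cases "w = 0") (simp_all add: householder_mult_vec inner_diff_right)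
  then have "householder w ** householder w = mat 1"
    by (simp add: matrix_eq flip: matrix_vector_mul_assoc)
  moreover have "transpose (householder w) = householder w"
    by (simp add: householder_def transpose_def vec_eq_iff mult_ac)
  ultimately show ?thesis by (simp add: orthogonal_matrix)
qed

lemma trace_mult_householder:
  "trace (M ** householder w) = trace M - 2 * (w \<bullet> (M *v w)) / (w \<bullet> w)"
proof -
  have "trace (M ** householder w) = trace (householder w ** M)" by (rule trace_mul_sym)
  also have "\<dots> = (\<Sum>i\<in>UNIV. (householder w *v column i M) $ i)"
    by (simp add: trace_def matrix_matrix_mult_def matrix_vector_mult_def column_def)
  also have "\<dots> = trace M - (\<Sum>i\<in>UNIV. 2 * (w \<bullet> column i M) / (w \<bullet> w) * w $ i)"
    by (simp add: householder_mult_vec trace_def column_def sum_subtractf)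
  also have "(\<Sum>i\<in>UNIV. 2 * (w \<bullet> column i M) / (w \<bullet> w) * w $ i)
      = 2 / (w \<bullet> w) * (\<Sum>i\<in>UNIV. (w \<bullet> column i M) * w $ i)"
    by (simp add: sum_distrib_left mult_ac)
  also have "(\<Sum>i\<in>UNIV. (w \<bullet> column i M) * w $ i) = w \<bullet> (M *v w)"
    unfolding dot_lmul_matrix[symmetric]
    by (simp add: inner_vec_def vector_matrix_mult_def column_def mult_ac)
  finally show ?thesis by simp
qed

lemma compact_orthogonal_matrices: "compact {Q :: real ^ 'n ^ 'n. orthogonal_matrix Q}"
proof -
  have "norm Q \<le> real CARD('n)" if "orthogonal_matrix Q" for Q :: "real ^ 'n ^ 'n"
  proof -
    have "norm Q \<le> (\<Sum>i\<in>UNIV. norm (Q $ i))"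
      unfolding norm_vec_def by (rule L2_set_le_sum) simp
    also have "\<dots> = real CARD('n)"
      using that by (simp add: orthogonal_matrix_orthonormal_rows row_def vec_lambda_eta)
    finally show ?thesis .
  qed
  then have "bounded {Q :: real ^ 'n ^ 'n. orthogonal_matrix Q}"
    by (auto simp: bounded_iff)
  moreover have "closed {Q :: real ^ 'n ^ 'n. orthogonal_matrix Q}"
    unfolding orthogonal_matrix matrix_matrix_mult_def transpose_def
    by (intro closed_Collect_eq continuous_intros)
  ultimately show ?thesis by (simp add: compact_eq_bounded_closed)
qed

text \<open>
  Let \<open>U\<close> maximise \<open>trace (A U)\<close> and put \<open>M = A U\<close>, so that \<open>trace (M Q) \<le> trace M\<close> for every
  orthogonal \<open>Q\<close>. Taking for \<open>Q\<close> the reflection along \<open>x\<close> gives \<open>x \<bullet> M x \<ge> 0\<close>. Taking for \<open>Q\<close> a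
  product of two reflections, which is a rotation by a small angle in the plane of orthonormal
  vectors \<open>x\<close> and \<open>y\<close>, gives the first-order condition \<open>y \<bullet> M x \<le> x \<bullet> M y\<close>, and by exchanging
  \<open>x\<close> and \<open>y\<close> the symmetry of \<open>M\<close>.
\<close>
lemma polar_decomposition:
  fixes A :: "real ^ 'n ^ 'n"
  obtains U where "orthogonal_matrix U" and "pos_semidef (A ** U)"
proof -
  let ?O = "{Q :: real ^ 'n ^ 'n. orthogonal_matrix Q}"
  have "continuous_on ?O (\<lambda>Q. trace (A ** Q))"
    unfolding trace_def matrix_matrix_mult_def by (simp, intro continuous_intros)
  moreover have "?O \<noteq> {}" using orthogonal_matrix_id by auto
  ultimately obtain U where U: "orthogonal_matrix U"
    and U_max: "\<And>Q. orthogonal_matrix Q \<Longrightarrow> trace (A ** Q) \<le> trace (A ** U)"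
    using continuous_attains_sup[OF compact_orthogonal_matrices] by (metis mem_Collect_eq)
  define M where "M = A ** U"
  have max: "trace (M ** Q) \<le> trace M" if "orthogonal_matrix Q" for Q
    using U_max[OF orthogonal_matrix_mul[OF U that]]
    by (simp add: M_def matrix_mul_assoc)
  have psd: "0 \<le> x \<bullet> (M *v x)" for x
  proof (cases "x = 0")
    case False
    then have "0 < x \<bullet> x" by simp
    with max[OF orthogonal_matrix_householder, of x] show ?thesis
      by (simp add: trace_mult_householder divide_simps)
  qed simp
  have le: "y \<bullet> (M *v x) \<le> x \<bullet> (M *v y)" if xy: "norm x = 1" "norm y = 1" "x \<bullet> y = 0" for x y
  proof (rule field_le_epsilon)
    fix e :: real assume "e > 0"
    \<comment> \<open>Up to a positive factor, the rotation composed of the reflections along \<open>x\<close> and \<open>x + t y\<close>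
      decreases the trace by \<open>t (x \<bullet> M y - y \<bullet> M x) + t\<^sup>2 s\<close>; the step size \<open>t\<close> is
      chosen so that after division by \<open>t\<close> the error is at most \<open>e\<close>.\<close>
    define s where "s = x \<bullet> (M *v x) + y \<bullet> (M *v y)"
    have "s \<ge> 0" using psd by (simp add: s_def)
    define t where "t = e / (s + 1)"
    have t: "t > 0" using \<open>e > 0\<close> \<open>s \<ge> 0\<close> by (simp add: t_def)
    have sq: "x \<bullet> x = 1" "y \<bullet> y = 1" "y \<bullet> x = 0" using xy by (simp_all add: norm_eq_1 inner_commute)
    let ?w = "x + t *\<^sub>R y"
    have w: "?w \<bullet> ?w = 1 + t\<^sup>2"
      by (simp add: inner_add_left inner_add_right sq xy power2_eq_square)
    have hw: "householder x *v ?w = t *\<^sub>R y - x"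
      by (simp add: householder_mult_vec inner_add_right sq xy algebra_simps scaleR_2)
    have "trace (M ** (householder x ** householder ?w)) \<le> trace M"
      by (intro max orthogonal_matrix_mul orthogonal_matrix_householder)
    then have "trace ((M ** householder x) ** householder ?w) \<le> trace M"
      by (simp add: matrix_mul_assoc)
    then have "0 \<le> x \<bullet> (M *v x) + (?w \<bullet> (M *v (t *\<^sub>R y - x))) / (1 + t\<^sup>2)"
      unfolding trace_mult_householder w sq matrix_vector_mul_assoc[symmetric] hw by simp
    moreover have "1 + t\<^sup>2 > 0" by (simp add: add_pos_nonneg)
    ultimately have "0 \<le> (1 + t\<^sup>2) * (x \<bullet> (M *v x)) + ?w \<bullet> (M *v (t *\<^sub>R y - x))"
      by (simp add: field_simps)
    also have "\<dots> = t * (x \<bullet> (M *v y) - y \<bullet> (M *v x) + t * s)"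
      by (simp add: s_def inner_add_left inner_diff_right matrix_vector_mult_diff_distrib
          matrix_vector_mult_scaleR algebra_simps power2_eq_square)
    finally have "y \<bullet> (M *v x) \<le> x \<bullet> (M *v y) + t * s"
      using t by (simp add: zero_le_mult_iff)
    also have "t * s \<le> e" using \<open>e > 0\<close> \<open>s \<ge> 0\<close> by (simp add: t_def field_simps)
    finally show "y \<bullet> (M *v x) \<le> x \<bullet> (M *v y) + e" by simp
  qed
  have comp: "axis i 1 \<bullet> (M *v axis j 1) = M $ i $ j" for i j
    by (simp add: inner_axis' matrix_vector_mult_basis column_def)
  have "M $ i $ j \<le> M $ j $ i" for i j
  proof (cases "i = j")
    case False
    then show ?thesis using le[of "axis j 1" "axis i 1"]
      by (simp add: comp inner_axis_axis)
  qed simp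
  then have "transpose M = M"
    by (simp add: transpose_def vec_eq_iff order_antisym)
  with psd have "pos_semidef (A ** U)" by (simp add: pos_semidef_def M_def)
  with U show thesis by (rule that)
qed

text \<open>
  If \<open>A U\<close> is symmetric, then \<open>(A U)\<^sup>2 = A U U\<^sup>T A\<^sup>T\<close>, and the orthogonal factor cancels.
\<close>
lemma
  fixes A :: "real ^ 'n ^ 'n"
  shows pos_semidef_matrix_abs: "pos_semidef (matrix_abs A)"
    and matrix_abs_square: "matrix_abs A ** matrix_abs A = A ** transpose A"
proof -
  obtain U where U: "orthogonal_matrix U" and psd: "pos_semidef (A ** U)"
    by (rule polar_decomposition)
  have "(A ** U) ** (A ** U) = (A ** U) ** transpose (A ** U)"
    using psd by (simp add: pos_semidef_def)
  also have "\<dots> = A ** (U ** transpose U) ** transpose A"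
    by (simp add: matrix_transpose_mul matrix_mul_assoc)
  also have "\<dots> = A ** transpose A"
    using U by (simp add: orthogonal_matrix_def)
  finally have sq: "(A ** U) ** (A ** U) = A ** transpose A" .
  then have "matrix_abs A = A ** U"
    unfolding matrix_abs_def using psd by (intro psd_sqrt_eqI)
  with psd sq show "pos_semidef (matrix_abs A)"
    "matrix_abs A ** matrix_abs A = A ** transpose A" by simp_all
qed

section \<open>Contractions and partial isometries\<close>

text \<open>
  This is \<open>\<lambda>\<^sup>2 \<le> \<lambda>\<close> for eigenvalues in the unit interval. It follows from evaluating the form of \<open>P\<close>
  at \<open>x - P x\<close>: with \<open>y = P x\<close>, nonnegativity reads \<open>0 \<le> x \<bullet> P x - 2 (y \<bullet> y) + y \<bullet> P y\<close>, and the last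
  term is at most \<open>y \<bullet> y\<close>.
\<close>
lemma pos_semidef_contraction_square_le:
  assumes "pos_semidef P" and contr: "\<And>y. norm (P *v y) \<le> norm y"
  shows "x \<bullet> ((P ** P) *v x) \<le> x \<bullet> (P *v x)"
proof -
  have sym: "transpose P = P" using assms(1) by (simp add: pos_semidef_def)
  define y where "y = P *v x"
  have "0 \<le> (x - y) \<bullet> (P *v (x - y))" using assms(1) by (simp add: pos_semidef_def)
  also have "\<dots> = x \<bullet> (P *v x) - 2 * (y \<bullet> y) + y \<bullet> (P *v y)"
    by (simp add: matrix_vector_mult_diff_distrib inner_diff_left inner_diff_right y_def
        inner_symmetric_matrix[OF sym])
  also have "y \<bullet> (P *v y) \<le> y \<bullet> y"
  proof -
    have "y \<bullet> (P *v y) \<le> norm y * norm (P *v y)" by (rule norm_cauchy_schwarz)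
    also have "\<dots> \<le> norm y * norm y" using contr by (intro mult_left_mono) auto
    finally show ?thesis by (simp add: power2_norm_eq_inner flip: power2_eq_square)
  qed
  finally have "y \<bullet> y \<le> x \<bullet> (P *v x)" by simp
  then show ?thesis
    by (simp add: y_def inner_symmetric_matrix[OF sym] matrix_vector_mul_assoc)
qed

text \<open>
  From \<open>|A|\<^sup>2 = A A\<^sup>T\<close> the vectors \<open>|A| x\<close> and \<open>A\<^sup>T x\<close> have the same length, so \<open>|A|\<close> inherits the
  contraction property and dominates \<open>|A|\<^sup>2 = A A\<^sup>T\<close>.
\<close>
lemma diagonal_matrix_abs_ge:
  fixes A :: "real ^ 'n ^ 'n"
  assumes contr: "\<And>x. norm (transpose A *v x) \<le> norm x"
  shows "(A ** transpose A) $ i $ i \<le> matrix_abs A $ i $ i"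
proof -
  let ?P = "matrix_abs A"
  have sym: "transpose ?P = ?P" using pos_semidef_matrix_abs by (auto simp: pos_semidef_def)
  have "norm (?P *v x) \<le> norm x" for x
  proof -
    have "(?P *v x) \<bullet> (?P *v x) = x \<bullet> ((A ** transpose A) *v x)"
      by (simp add: inner_symmetric_matrix[OF sym] matrix_vector_mul_assoc matrix_abs_square)
    also have "\<dots> = (transpose A *v x) \<bullet> (transpose A *v x)"
      by (simp add: dot_lmul_matrix flip: matrix_vector_mul_assoc)
    finally show ?thesis using contr[of x] by (simp add: norm_eq_sqrt_inner)
  qed
  from pos_semidef_contraction_square_le[OF pos_semidef_matrix_abs this, of "axis i 1"]
  show ?thesis
    by (simp add: matrix_abs_square inner_axis' matrix_vector_mult_basis column_def)
qed

lemma pos_semidef_mult_transpose: "pos_semidef (A ** transpose A)"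
proof -
  have "x \<bullet> ((A ** transpose A) *v x) = (transpose A *v x) \<bullet> (transpose A *v x)" for x
    by (simp add: dot_lmul_matrix flip: matrix_vector_mul_assoc)
  then show ?thesis by (simp add: pos_semidef_def matrix_transpose_mul)
qed

text \<open>
  For a partial isometry \<open>A A\<^sup>T\<close> is an orthogonal projection, hence its own square root.
\<close>
lemma matrix_abs_partial_isometry:
  assumes "A ** transpose A ** A = A"
  shows "matrix_abs A = A ** transpose A"
  unfolding matrix_abs_def
  by (rule psd_sqrt_eqI[OF pos_semidef_mult_transpose]) (simp add: matrix_mul_assoc assms)

section \<open>Lower bound for the energy of a vertex\<close>

lemma (in digraph) out_degree_eq_card_neighbours:
  "out_degree G u = card {w. u \<rightarrow>\<^bsub>G\<^esub> w}"
proof -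
  have "head G ` out_arcs G u = {w. u \<rightarrow>\<^bsub>G\<^esub> w}"
    by (auto simp: out_arcs_def arcs_ends_conv)
  moreover have "inj_on (head G) (out_arcs G u)"
    by (auto simp: inj_on_def out_arcs_def arc_to_ends_def intro: no_multi_arcs)
  ultimately show ?thesis unfolding out_degree_def by (metis card_image)
qed

lemma transpose_randic_matrix:
  assumes "graph G"
  shows "transpose (randic_matrix G) = randic_matrix G"
proof -
  interpret graph G by fact
  show ?thesis
    using arcs_ends_symmetric[OF sym_arcs]
    by (auto simp: transpose_def randic_matrix_def vec_eq_iff mult.commute)
qed

text \<open>
  By the Cauchy--Schwarz inequality the square of the entry of \<open>R x\<close> at \<open>u\<close> is at most the sum of
  \<open>x\<^sub>w\<^sup>2 / d\<^sub>w\<close> over the neighbours \<open>w\<close> of \<open>u\<close>, since the other factor is \<open>d\<^sub>u\<close> times \<open>1 / d\<^sub>u\<close>. In the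
  sum over all \<open>u\<close>, each \<open>x\<^sub>w\<^sup>2 / d\<^sub>w\<close> occurs once for each of the \<open>d\<^sub>w\<close> neighbours of \<open>w\<close>.
\<close>
lemma norm_randic_matrix_mult_le:
  assumes "graph G"
  shows "norm (randic_matrix G *v x) \<le> norm x"
proof -
  interpret graph G by fact
  define N where "N u = {w. u \<rightarrow>\<^bsub>G\<^esub> w}" for u
  define d where "d u = real (card (N u))" for u
  have deg: "real (out_degree G u) = d u" for u
    by (simp add: d_def N_def out_degree_eq_card_neighbours)
  have swap: "{u. w \<in> N u} = N w" for w
    using arcs_ends_symmetric[OF sym_arcs] by (auto simp: N_def)
  have comp: "(randic_matrix G *v x) $ u = (\<Sum>w\<in>N u. (x $ w / sqrt (d w)) * (1 / sqrt (d u)))" for u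
  proof -
    have "(randic_matrix G *v x) $ u
        = (\<Sum>w\<in>UNIV. if w \<in> N u then (x $ w / sqrt (d w)) * (1 / sqrt (d u)) else 0)"
      unfolding randic_matrix_def matrix_vector_mult_def
      by (auto simp: deg N_def real_sqrt_mult intro!: sum.cong)
    then show ?thesis by (simp add: sum.If_cases)
  qed
  have row: "((randic_matrix G *v x) $ u)\<^sup>2 \<le> (\<Sum>w\<in>N u. (x $ w)\<^sup>2 / d w)" for u
  proof -
    have "((randic_matrix G *v x) $ u)\<^sup>2
        \<le> (\<Sum>w\<in>N u. (x $ w / sqrt (d w))\<^sup>2) * (\<Sum>w\<in>N u. (1 / sqrt (d u))\<^sup>2)"
      unfolding comp by (rule Cauchy_Schwarz_ineq_sum)
    also have "(\<Sum>w\<in>N u. (x $ w / sqrt (d w))\<^sup>2) = (\<Sum>w\<in>N u. (x $ w)\<^sup>2 / d w)"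
      by (simp add: power_divide d_def)
    \<comment> \<open>This factor is \<open>0\<close> rather than \<open>1\<close> if \<open>u\<close> is isolated.\<close>
    also have "(\<Sum>w\<in>N u. (1 / sqrt (d u))\<^sup>2) = d u / d u"
      by (simp add: power_divide d_def)
    also have "(\<Sum>w\<in>N u. (x $ w)\<^sup>2 / d w) * (d u / d u) \<le> (\<Sum>w\<in>N u. (x $ w)\<^sup>2 / d w)"
      by (intro mult_right_le_one_le sum_nonneg) (auto simp: d_def divide_simps)
    finally show ?thesis .
  qed
  have "(norm (randic_matrix G *v x))\<^sup>2 = (\<Sum>u\<in>UNIV. ((randic_matrix G *v x) $ u)\<^sup>2)"
    unfolding power2_norm_eq_inner inner_vec_def by (simp add: power2_eq_square)
  also have "\<dots> \<le> (\<Sum>u\<in>UNIV. \<Sum>w\<in>N u. (x $ w)\<^sup>2 / d w)"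
    by (intro sum_mono row)
  also have "\<dots> = (\<Sum>w\<in>UNIV. \<Sum>u\<in>N w. (x $ w)\<^sup>2 / d w)"
    using sum.swap_restrict[of UNIV UNIV "\<lambda>u w. (x $ w)\<^sup>2 / d w" "\<lambda>u w. w \<in> N u"]
    by (simp add: swap)
  also have "\<dots> \<le> (\<Sum>w\<in>UNIV. (x $ w)\<^sup>2)"
    by (intro sum_mono) (auto simp: d_def)
  also have "\<dots> = (norm x)\<^sup>2"
    unfolding power2_norm_eq_inner inner_vec_def by (simp add: power2_eq_square)
  finally show ?thesis by (simp add: power2_le_iff_abs_le)
qed

lemma (in graph) exists_neighbour:
  assumes "Digraph_Component.connected G" and "v \<in> verts G" "w \<in> verts G" "v \<noteq> w"
  shows "\<exists>u. v \<rightarrow>\<^bsub>G\<^esub> u"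
proof -
  have "v \<rightarrow>\<^sup>*\<^bsub>mk_symmetric G\<^esub> w"
    using assms by (simp add: connected_def strongly_connected_def)
  then have "v \<rightarrow>\<^sup>*\<^bsub>G\<^esub> w" using reachable_mk_symmetric_eq[OF sym_arcs] by simp
  then have "(v, w) \<in> (arcs_ends G)\<^sup>*" by (rule reachable_rtranclI)
  with \<open>v \<noteq> w\<close> show ?thesis by (auto elim: converse_rtranclE)
qed

text \<open>
  The diagonal entry of \<open>R R\<^sup>T\<close> at \<open>v\<close> has \<open>d\<^sub>v\<close> terms \<open>1 / (d\<^sub>v d\<^sub>w)\<close>, each at least
  \<open>1 / (d\<^sub>v (n - 1))\<close>.
\<close>
lemma randic_energy_ge:
  fixes G :: "('v::finite, 'e) pre_digraph"
  assumes "graph G" and "\<exists>w. v \<rightarrow>\<^bsub>G\<^esub> w"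
  shows "1 / (real CARD('v) - 1) \<le> randic_energy G v"
proof -
  interpret graph G by fact
  let ?R = "randic_matrix G"
  define N where "N u = {w. u \<rightarrow>\<^bsub>G\<^esub> w}" for u
  define d where "d u = real (card (N u))" for u
  have deg: "real (out_degree G u) = d u" for u
    by (simp add: d_def N_def out_degree_eq_card_neighbours)
  have d_pos: "0 < d u" if "w \<in> N u" for u w
    using that by (auto simp: d_def card_gt_0_iff)
  have d_le: "d u \<le> real CARD('v) - 1" for u
  proof -
    have "u \<notin> N u" by (auto simp: N_def dest: adj_not_same)
    then have "Suc (card (N u)) = card (insert u (N u))" by simp
    also have "\<dots> \<le> CARD('v)" by (rule card_mono) auto
    finally show ?thesis by (simp add: d_def)
  qed
  have sym: "v \<in> N w" if "w \<in> N v" for w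
    using that arcs_ends_symmetric[OF sym_arcs] by (auto simp: N_def)
  obtain w0 where "w0 \<in> N v" using assms(2) by (auto simp: N_def)
  then have "0 < d v" by (rule d_pos)
  have "1 / (real CARD('v) - 1) = (\<Sum>w\<in>N v. 1 / (d v * (real CARD('v) - 1)))"
    using \<open>0 < d v\<close> by (auto simp: d_def)
  also have "\<dots> \<le> (\<Sum>w\<in>N v. 1 / (d v * d w))"
  proof (rule sum_mono)
    fix w assume "w \<in> N v"
    then have "0 < d w" by (rule d_pos[OF sym])
    with \<open>0 < d v\<close> d_le[of w] show "1 / (d v * (real CARD('v) - 1)) \<le> 1 / (d v * d w)"
      by (intro divide_left_mono mult_left_mono mult_pos_pos) auto
  qed
  also have "\<dots> = (\<Sum>w\<in>UNIV. if w \<in> N v then 1 / (d v * d w) else 0)"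
    by (simp add: sum.If_cases)
  also have "\<dots> = (?R ** transpose ?R) $ v $ v"
    unfolding matrix_matrix_mult_def transpose_def randic_matrix_def
    by (auto simp: deg N_def d_def intro!: sum.cong)
  also have "\<dots> \<le> matrix_abs ?R $ v $ v"
    by (intro diagonal_matrix_abs_ge)
      (simp only: transpose_randic_matrix[OF assms(1)] norm_randic_matrix_mult_le[OF assms(1)])
  finally show ?thesis by (simp add: randic_energy_def)
qed

section \<open>The pendant vertices of a star\<close>

text \<open>
  Only the entries of \<open>R\<close> between the centre and a leaf are nonzero, and they all equal \<open>1 / sqrt m\<close>.
  So \<open>R R\<^sup>T\<close> is the projection onto the span of the unit vector at the centre and the normalised
  indicator vector of the leaves, and \<open>R\<close> exchanges these two vectors.
\<close>
lemma randic_energy_star_pendant: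
  fixes S :: "('w::finite, 'f) pre_digraph"
  assumes star: "complete_bipartite_digraph 1 m S" and "verts S = UNIV" and "m \<ge> 1"
    and "pendant S u"
  shows "randic_energy S u = 1 / real m"
proof -
  from star obtain U V where UV: "graph S" "UNIV = U \<union> V" "U \<inter> V = {}" "card U = 1" "card V = m"
    "arcs_ends S = U \<times> V \<union> V \<times> U"
    unfolding complete_bipartite_digraph_def assms(2) by metis
  interpret graph S by fact
  obtain c where c: "U = {c}" using UV(4) by (metis card_1_singletonE)
  have V: "V = - {c}" using UV(2,3) c by auto
  have adj: "a \<rightarrow>\<^bsub>S\<^esub> b \<longleftrightarrow> (a = c) \<noteq> (b = c)" for a b
    by (auto simp: UV(6) c V)
  have deg: "out_degree S a = (if a = c then m else 1)" for a
  proof -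
    have "{b. a \<rightarrow>\<^bsub>S\<^esub> b} = (if a = c then V else {c})"
      by (auto simp: adj V)
    then show ?thesis using UV(5) by (simp add: out_degree_eq_card_neighbours)
  qed
  let ?R = "randic_matrix S"
  define s where "s = 1 / sqrt (real m)"
  have s2: "real m * (s * s) = 1" "s * s = 1 / real m"
    using \<open>m \<ge> 1\<close> by (simp_all add: s_def)
  have R: "?R $ a $ b = (if (a = c) \<noteq> (b = c) then s else 0)" for a b
    by (simp add: randic_matrix_def adj deg s_def)
  have split: "sum f UNIV = f c + sum f V" for f :: "'w \<Rightarrow> real"
    using sum.remove[of UNIV c f] by (simp add: V Compl_eq_Diff_UNIV)
  have VD: "b \<in> V \<Longrightarrow> b \<noteq> c" for b by (simp add: V)
  have E: "(?R ** transpose ?R) $ a $ b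
      = (if (a = c) = (b = c) then (if a = c then 1 else 1 / real m) else 0)" for a b
    unfolding matrix_matrix_mult_def transpose_def
    using s2 UV(5) by (simp add: split R VD cong: sum.cong)
  have "(?R ** transpose ?R ** ?R) $ a $ b = ?R $ a $ b" for a b
    unfolding matrix_matrix_mult_def[of "?R ** transpose ?R"]
    using \<open>m \<ge> 1\<close> UV(5) by (simp add: split E R VD cong: sum.cong)
  then have "matrix_abs ?R = ?R ** transpose ?R"
    by (intro matrix_abs_partial_isometry) (simp add: vec_eq_iff)
  \<comment> \<open>The star with two vertices has a pendant centre, at which the value \<open>1\<close> is again \<open>1 / m\<close>.\<close>
  moreover have "u = c \<Longrightarrow> m = 1"
    using \<open>pendant S u\<close> by (simp add: pendant_def deg)
  ultimately show ?thesis by (simp add: randic_energy_def E)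
qed

theorem corollary3p2:
  fixes n :: nat
    and S :: "('w::finite, 'f) pre_digraph" and u :: 'w
    and G :: "('v::finite, 'e) pre_digraph" and v :: 'v
  assumes "n \<ge> 2"
    and "complete_bipartite_digraph 1 (n - 1) S" and "verts S = UNIV" and "pendant S u"
    and "graph G" and "Digraph_Component.connected G" and "verts G = UNIV" and "CARD('v) = n"
  shows "randic_energy G v \<ge> randic_energy S u"
proof -
  have "CARD('v) \<noteq> card {v}" using assms(1,8) by simp
  then have "(UNIV :: 'v set) \<noteq> {v}" by metis
  then obtain w where "w \<noteq> v" by auto
  then have "\<exists>w. v \<rightarrow>\<^bsub>G\<^esub> w"
    using graph.exists_neighbour[OF assms(5,6), of v w] assms(7) by auto
  have "randic_energy S u = 1 / real (n - 1)"
    using assms(1-4) by (intro randic_energy_star_pendant) auto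
  also have "\<dots> = 1 / (real CARD('v) - 1)"
    using assms(1,8) by (simp add: of_nat_diff)
  also have "\<dots> \<le> randic_energy G v"
    by (rule randic_energy_ge) fact+
  finally show ?thesis .
qed

end
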